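(* Let $n\ge 1$ and $m\geq 2$ be integers, and let $A_1,\dots,A_m\in\mathbb{R}^{n\times n}$ be such that for each $i=3,\dots,m$ there is $(\alpha_i,\beta_i)\in\mathbb{R}^2$ with $A_i=\alpha_i A_1+\beta_i A_2$. Let $K\subseteq\mathbb{R}^n$ be a first-order cone. Then the following two conditions are equivalent: (1) $\max_{i=1,\dots,m}\{x^{T}A_i x\}\geq 0$ for all $x\in K$; (2) there exists $t\in\Lambda_m$ such that $\sum_{i=1}^m t_iA_i$ is positive semidefinite on $K$.
   Context: A set $K\subseteq\mathbb{R}^n$ is a first-order cone if it is the direct sum of a subspace and a ray, i.e. $K=\{s+t d_0 \mid s\in S,\ t\ge 0\}$ for some linear subspace $S\subseteq\mathbb{R}^n$ and some $d_0\in\mathbb{R}^n$ (a ray is a set of the form $\{td_0\mid t\geq 0\}$ with $d_0\in\mathbb{R}^n$). A matrix $A\in\mathbb{R}^{n\times n}$ is positive semidefinite on $K$ if $x^{T}Ax\geq 0$ for all $x\in K$. $\Lambda_m=\{t\in\mathbb{R}^m \mid t_i\ge 0 \text{ for all } i,\ \sum_{i=1}^m t_i=1\}$. *)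

theory Defs
  imports "HOL-Analysis.Analysis"
begin

definition first_order_cone :: "(real^'n) set \<Rightarrow> bool" where
  "first_order_cone K \<longleftrightarrow>
     (\<exists>S d. subspace S \<and> K = {s + t *\<^sub>R d | s t. s \<in> S \<and> t \<ge> 0})"

definition psd_on :: "real^'n^'n \<Rightarrow> (real^'n) set \<Rightarrow> bool" where
  "psd_on A K \<longleftrightarrow> (\<forall>x\<in>K. x \<bullet> (A *v x) \<ge> 0)"

text \<open>
  Points of $\mathbb{R}^m$ are represented by functions on the naturals of which only the values
  at $1, \dots, m$ matter; the values elsewhere are unconstrained.
\<close>

definition unit_simplex :: "nat \<Rightarrow> (nat \<Rightarrow> real) set" where
  "unit_simplex m = {t. (\<forall>i\<in>{1..m}. t i \<ge> 0) \<and> (\<Sum>i=1..m. t i) = 1}"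

end

theory Submission
  imports Defs
begin

text \<open>
  A quadratic form is even, so its values on a first-order cone are its values on the subspace
  that the cone spans. On a subspace the joint range of two quadratic forms is a convex cone
  (Dines), and each \<open>A\<^sub>i\<close> is a fixed linear functional on that cone. The equivalence is then a
  theorem of the alternative for a convex cone and finitely many linear functionals.
\<close>

section \<open>A theorem of the alternative for convex cones\<close>

text \<open>One half of the bipolar theorem. A point outside \<open>closure W\<close> can be
  strictly separated from it; because \<open>W\<close> is a cone, the separating functional is
  nonnegative on all of \<open>W\<close> while staying negative at \<open>u\<close>.\<close>

lemma dual_cone_separation:
  fixes W :: "'a::euclidean_space set"
  assumes "cone W" "convex W" "W \<noteq> {}"
    and dual: "\<And>y. (\<And>w. w \<in> W \<Longrightarrow> y \<bullet> w \<ge> 0) \<Longrightarrow> y \<bullet> u \<ge> 0"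
  shows "u \<in> closure W"
proof (rule ccontr)
  assume "u \<notin> closure W"
  then obtain y b where yu: "y \<bullet> u < b" and yW: "\<And>w. w \<in> closure W \<Longrightarrow> y \<bullet> w > b"
    using separating_hyperplane_closed_point[of "closure W" u] assms(2)
    by (auto simp: convex_closure)
  have yW': "y \<bullet> w > b" if "w \<in> W" for w
    using yW closure_subset that by blast
  have "0 \<in> W" using assms(1,3) cone_contains_0 by blast
  then have b0: "b < 0" using yW'[of 0] by simp
  have "y \<bullet> w \<ge> 0" if w: "w \<in> W" for w
  proof (rule ccontr)
    assume "\<not> y \<bullet> w \<ge> 0"
    then have neg: "y \<bullet> w < 0" by simp
    \<comment> \<open>Both numbers are negative, so the factor is nonnegative; at the scaled point
      the functional takes exactly the forbidden value \<open>b\<close>.\<close>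
    then have "(b / (y \<bullet> w)) *\<^sub>R w \<in> W"
      using assms(1) w b0 by (auto simp: cone_def divide_nonpos_neg)
    from yW'[OF this] neg show False by simp
  qed
  then have "y \<bullet> u \<ge> 0" by (rule dual)
  with yu b0 show False by simp
qed

text \<open>The weights are indexed by \<open>I\<close> instead of by points of the hull, since
  \<open>l\<close> may repeat values. The combinations with such weights form a convex set
  containing every \<open>l i\<close>, so they contain the hull.\<close>

lemma convex_hull_image_simplex:
  fixes l :: "'i \<Rightarrow> 'a::real_vector"
  assumes "finite I"
    and "y \<in> convex hull (l ` I)"
  obtains t where "\<forall>i\<in>I. t i \<ge> (0::real)" "sum t I = 1" "y = (\<Sum>i\<in>I. t i *\<^sub>R l i)"
proof -
  let ?C = "{\<Sum>i\<in>I. t i *\<^sub>R l i | t. (\<forall>i\<in>I. t i \<ge> (0::real)) \<and> sum t I = 1}"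
  have "convex hull (l ` I) \<subseteq> ?C"
  proof (rule hull_minimal)
    show "l ` I \<subseteq> ?C"
    proof
      fix v assume "v \<in> l ` I"
      then obtain j where j: "j \<in> I" "v = l j" by auto
      have "v = (\<Sum>i\<in>I. (if i = j then 1 else 0) *\<^sub>R l i)"
        using j assms(1) by (simp add: if_distrib[of "\<lambda>c. c *\<^sub>R _"] cong: if_cong)
      moreover have "(\<Sum>i\<in>I. if i = j then 1 else 0 :: real) = 1"
        using j assms(1) by simp
      ultimately show "v \<in> ?C"
        by (intro CollectI exI[of _ "\<lambda>i. if i = j then 1 else 0"]) auto
    qed
    show "convex ?C"
      unfolding convex_def
    proof clarify
      fix u v :: real and s t :: "'i \<Rightarrow> real"
      assume h: "0 \<le> u" "0 \<le> v" "u + v = 1" "\<forall>i\<in>I. 0 \<le> s i" "sum s I = 1"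
        "\<forall>i\<in>I. 0 \<le> t i" "sum t I = 1"
      let ?r = "\<lambda>i. u * s i + v * t i"
      have "u *\<^sub>R (\<Sum>i\<in>I. s i *\<^sub>R l i) + v *\<^sub>R (\<Sum>i\<in>I. t i *\<^sub>R l i) = (\<Sum>i\<in>I. ?r i *\<^sub>R l i)"
        by (simp add: scaleR_sum_right sum.distrib scaleR_add_left)
      moreover have "sum ?r I = 1"
        using h by (simp add: sum.distrib flip: sum_distrib_left)
      moreover have "\<forall>i\<in>I. ?r i \<ge> 0" using h by simp
      ultimately show "\<exists>r. u *\<^sub>R (\<Sum>i\<in>I. s i *\<^sub>R l i) + v *\<^sub>R (\<Sum>i\<in>I. t i *\<^sub>R l i) =
          (\<Sum>i\<in>I. r i *\<^sub>R l i) \<and> (\<forall>i\<in>I. 0 \<le> r i) \<and> sum r I = 1"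
        by (intro exI[of _ ?r] conjI)
    qed
  qed
  with assms(2) show ?thesis using that by blast
qed

text \<open>The required weights are those of a common point of the convex hull of the
  \<open>l i\<close> and the dual cone \<open>D\<close>. If the two were disjoint, a vector
  \<open>u\<close> would strictly separate the compact hull from the closed cone; then
  \<open>u\<close> lies in \<open>closure W\<close> and has negative inner product with every
  \<open>l i\<close>, which contradicts \<open>nonneg\<close> after a small perturbation of
  \<open>u\<close> into \<open>W\<close>.\<close>

lemma convex_cone_alternative:
  fixes W :: "'a::euclidean_space set" and l :: "'i \<Rightarrow> 'a"
  assumes "cone W" "convex W" "W \<noteq> {}" "finite I" "I \<noteq> {}"
    and nonneg: "\<And>w. w \<in> W \<Longrightarrow> \<exists>i\<in>I. l i \<bullet> w \<ge> 0"
  obtains t where "\<forall>i\<in>I. t i \<ge> 0" "sum t I = 1" "\<forall>w\<in>W. (\<Sum>i\<in>I. t i * (l i \<bullet> w)) \<ge> 0"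
proof -
  define D where "D = {y. \<forall>w\<in>W. y \<bullet> w \<ge> 0}"
  let ?C = "convex hull (l ` I)"
  have D_Inter: "D = (\<Inter>w\<in>W. {y. w \<bullet> y \<ge> 0})"
    by (auto simp: D_def inner_commute)
  have "closed D" unfolding D_Inter by (intro closed_INT ballI closed_halfspace_ge)
  have "convex D" unfolding D_Inter by (intro convex_INT convex_halfspace_ge)
  have "?C \<inter> D \<noteq> {}"
  proof
    assume "?C \<inter> D = {}"
    then obtain u b where uC: "\<And>y. y \<in> ?C \<Longrightarrow> u \<bullet> y < b" and uD: "\<And>y. y \<in> D \<Longrightarrow> u \<bullet> y > b"
      using separating_hyperplane_compact_closed[of ?C D] \<open>closed D\<close> \<open>convex D\<close> assms(4,5)
        finite_imp_compact_convex_hull[of "l ` I"] convex_hull_eq_empty[of "l ` I"]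
      by (metis convex_convex_hull finite_imageI image_is_empty)
    have "0 \<in> D" by (simp add: D_def)
    then have b0: "b < 0" using uD by fastforce
    have "u \<in> closure W"
    proof (rule dual_cone_separation[OF assms(1-3)])
      fix y assume y: "\<And>w. w \<in> W \<Longrightarrow> y \<bullet> w \<ge> 0"
      show "y \<bullet> u \<ge> 0"
      proof (rule ccontr)
        assume "\<not> y \<bullet> u \<ge> 0"
        then have neg: "u \<bullet> y < 0" by (simp add: inner_commute)
        \<comment> \<open>\<open>D\<close> is a cone too, so a negative value at \<open>y\<close>
          could be scaled to the value \<open>b\<close>, which the separation excludes on
          \<open>D\<close>.\<close>
        then have "(b / (u \<bullet> y)) *\<^sub>R y \<in> D"
          using y b0 by (auto simp: D_def intro!: divide_nonpos_neg mult_nonpos_nonneg)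
        from uD[OF this] neg show False by simp
      qed
    qed
    moreover
    \<comment> \<open>Since \<open>u\<close> is only known to lie in the closure of
      \<open>W\<close>, openness of \<open>P\<close> is used to find a point of \<open>W\<close>
      itself where all functionals are negative.\<close>
    define P where "P = (\<Inter>i\<in>I. {v. l i \<bullet> v < 0})"
    have "open P" unfolding P_def using assms(4) by (intro open_INT ballI open_halfspace_lt)
    moreover have "u \<in> P"
      using uC b0 hull_inc[of _ "l ` I" convex] unfolding P_def
      by (force simp: inner_commute)
    ultimately have "P \<inter> W \<noteq> {}"
      using open_Int_closure_eq_empty[of P W] by auto
    then obtain w where "w \<in> P" "w \<in> W" by auto
    with nonneg show False by (force simp: P_def)
  qed
  then obtain y where "y \<in> ?C" "y \<in> D" by auto
  from \<open>y \<in> ?C\<close> obtain t where t: "\<forall>i\<in>I. t i \<ge> 0" "sum t I = 1" "y = (\<Sum>i\<in>I. t i *\<^sub>R l i)"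
    by (rule convex_hull_image_simplex[OF assms(4)])
  have "\<forall>w\<in>W. (\<Sum>i\<in>I. t i * (l i \<bullet> w)) \<ge> 0"
    using \<open>y \<in> D\<close> unfolding D_def t(3) by (simp add: inner_sum_left)
  with t show ?thesis using that by blast
qed

section \<open>The joint range of two quadratic forms\<close>

lemma quadratic_form_scaleR:
  fixes A :: "real^'n^'n"
  shows "(c *\<^sub>R x) \<bullet> (A *v (c *\<^sub>R x)) = c\<^sup>2 * (x \<bullet> (A *v x))"
  by (simp add: matrix_vector_mult_scaleR power2_eq_square)

lemma quadratic_form_scaleR_add:
  fixes A :: "real^'n^'n"
  shows "(s *\<^sub>R x + y) \<bullet> (A *v (s *\<^sub>R x + y)) =
    s\<^sup>2 * (x \<bullet> (A *v x)) + s * (x \<bullet> (A *v y) + y \<bullet> (A *v x)) + y \<bullet> (A *v y)"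
  by (simp add: matrix_vector_mult_scaleR matrix_vector_right_distrib inner_add_left
      inner_add_right power2_eq_square algebra_simps)

definition joint_quadratic :: "real^'n^'n \<Rightarrow> real^'n^'n \<Rightarrow> real^'n \<Rightarrow> real \<times> real" where
  "joint_quadratic A B x = (x \<bullet> (A *v x), x \<bullet> (B *v x))"

lemma joint_quadratic_scaleR: "joint_quadratic A B (c *\<^sub>R x) = c\<^sup>2 *\<^sub>R joint_quadratic A B x"
  unfolding joint_quadratic_def quadratic_form_scaleR by simp

text \<open>Quadratic forms are homogeneous of degree two, so a factor \<open>k\<close> outside
  amounts to a factor \<open>sqrt k\<close> on the argument.\<close>

lemma nonneg_scaleR_joint_range:
  assumes "subspace T" "x \<in> T" "k \<ge> 0"
  shows "k *\<^sub>R joint_quadratic A B x \<in> joint_quadratic A B ` T"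
proof -
  have "k *\<^sub>R joint_quadratic A B x = joint_quadratic A B (sqrt k *\<^sub>R x)"
    using assms(3) by (simp add: joint_quadratic_scaleR)
  with assms show ?thesis by (simp add: subspace_scale)
qed

text \<open>The roots of the first equation have product -1, hence opposite signs. Taking the root
  whose sign agrees with that of \<open>g\<close> gives \<open>s * g\<close> nonnegative, while
  \<open>s\<close> is nonzero.\<close>

lemma quadratic_root_with_sign:
  fixes e g :: real
  obtains s where "s\<^sup>2 + s * e = 1" "s\<^sup>2 + s * g > 0"
proof -
  define r where "r = sqrt (e\<^sup>2 + 4)"
  have r2: "r\<^sup>2 = e\<^sup>2 + 4" by (simp add: r_def)
  have r: "r > \<bar>e\<bar>" unfolding r_def by (rule real_less_rsqrt) simp
  have "(r - e) / 2 > 0" "(- r - e) / 2 < 0" using r by auto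
  moreover have "((r - e) / 2)\<^sup>2 + (r - e) / 2 * e = 1" "((- r - e) / 2)\<^sup>2 + (- r - e) / 2 * e = 1"
    using r2 by (simp_all add: power2_eq_square field_simps)
  ultimately show ?thesis
  proof (cases "g \<ge> 0")
    case True
    show ?thesis
      by (rule that[of "(r - e) / 2"]) (use True \<open>(r - e) / 2 > 0\<close> \<open>((r - e) / 2)\<^sup>2 + _ = 1\<close> in
          \<open>auto intro!: add_pos_nonneg\<close>)
  next
    case False
    have "(- r - e) / 2 * g > 0"
      using False \<open>(- r - e) / 2 < 0\<close> by (intro mult_neg_neg) auto
    then have "((- r - e) / 2)\<^sup>2 + (- r - e) / 2 * g > 0" by (intro add_nonneg_pos) auto
    then show ?thesis
      using \<open>((- r - e) / 2)\<^sup>2 + _ = 1\<close> by (rule that[rotated])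
  qed
qed

text \<open>If \<open>a = c *\<^sub>R b\<close>, the sum is \<open>c + 1\<close> times
  \<open>b\<close>, which settles c \<ge> -1; for smaller \<open>c\<close> it is
  \<open>1 + 1 / c\<close> times \<open>a\<close>. This is the degenerate case of adding two points
  of the joint range.\<close>

lemma parallel_add_nonneg_multiple:
  fixes a b :: "real \<times> real"
  assumes "fst a * snd b = snd a * fst b"
  shows "\<exists>k\<ge>0. a + b = k *\<^sub>R a \<or> a + b = k *\<^sub>R b"
proof (cases "b = 0")
  case True
  then show ?thesis by (intro exI[of _ 1]) auto
next
  case False
  then obtain c where c: "a = c *\<^sub>R b"
  proof (cases "fst b = 0")
    case True
    with False assms show ?thesis
      by (intro that[of "snd a / snd b"]) (auto simp: prod_eq_iff)
  next
    case False
    with assms show ?thesis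
      by (intro that[of "fst a / fst b"]) (auto simp: prod_eq_iff field_simps)
  qed
  show ?thesis
  proof (cases "c \<ge> -1")
    case True
    then show ?thesis by (intro exI[of _ "c + 1"]) (simp add: c scaleR_add_left)
  next
    case False
    then have "a + b = (1 + 1 / c) *\<^sub>R a" "1 + 1 / c \<ge> 0"
      by (simp_all add: c scaleR_add_left distrib_right field_simps del: scaleR_scaleR)
        (simp add: scaleR_add_left)
    then show ?thesis by blast
  qed
qed

text \<open>The core of Dines' theorem. When the images of \<open>x\<close> and \<open>y\<close> are
  linearly independent, some \<open>s *\<^sub>R x + y\<close> has an image that is a positive
  multiple of their sum, and homogeneity removes the factor.\<close>

lemma joint_range_add:
  assumes T: "subspace T" and xy: "x \<in> T" "y \<in> T"
  shows "joint_quadratic A B x + joint_quadratic A B y \<in> joint_quadratic A B ` T"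
proof -
  let ?q = "joint_quadratic A B"
  define a1 a2 b1 b2 where "a1 = x \<bullet> (A *v x)" and "a2 = x \<bullet> (B *v x)"
    and "b1 = y \<bullet> (A *v y)" and "b2 = y \<bullet> (B *v y)"
  define c1 c2 where "c1 = x \<bullet> (A *v y) + y \<bullet> (A *v x)" and "c2 = x \<bullet> (B *v y) + y \<bullet> (B *v x)"
  have qx: "?q x = (a1, a2)" and qy: "?q y = (b1, b2)"
    by (simp_all add: joint_quadratic_def a1_def a2_def b1_def b2_def)
  have qz: "?q (s *\<^sub>R x + y) = (s\<^sup>2 * a1 + s * c1 + b1, s\<^sup>2 * a2 + s * c2 + b2)" for s
    by (simp add: joint_quadratic_def quadratic_form_scaleR_add a1_def a2_def b1_def b2_def
        c1_def c2_def)
  define det where "det = a1 * b2 - a2 * b1"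
  show ?thesis
  proof (cases "det = 0")
    case True
    then have "\<exists>k\<ge>0. ?q x + ?q y = k *\<^sub>R ?q x \<or> ?q x + ?q y = k *\<^sub>R ?q y"
      by (intro parallel_add_nonneg_multiple) (simp add: qx qy det_def)
    then show ?thesis using nonneg_scaleR_joint_range[OF T] xy by metis
  next
    case False
    \<comment> \<open>\<open>(c1, c2)\<close> has coordinates \<open>(g, h)\<close> in the basis \<open>?q x\<close>, \<open>?q y\<close>; the choice of \<open>s\<close> makes
      both coordinates of \<open>?q (s x + y)\<close> equal to the same positive number.\<close>
    define g h where "g = (c1 * b2 - c2 * b1) / det" and "h = (a1 * c2 - a2 * c1) / det"
    \<comment> \<open>Cramer's rule, with the denominators cleared.\<close>
    have "det * c1 = det * (g * a1 + h * b1)" "det * c2 = det * (g * a2 + h * b2)"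
      using False by (simp_all add: g_def h_def distrib_left) (simp_all add: det_def algebra_simps)
    with False have c: "c1 = g * a1 + h * b1" "c2 = g * a2 + h * b2" by simp_all
    \<comment> \<open>The coordinates of \<open>?q (s *\<^sub>R x + y)\<close> are
      \<open>s\<^sup>2 + s * g\<close> and \<open>1 + s * h\<close>; the equation says that they
      agree, the inequality that they are positive.\<close>
    obtain s where s: "s\<^sup>2 + s * (g - h) = 1" "s\<^sup>2 + s * g > 0"
      by (rule quadratic_root_with_sign)
    define k where "k = s\<^sup>2 + s * g"
    have k1: "1 + s * h = k" using s(1) by (simp add: k_def algebra_simps)
    have "?q (s *\<^sub>R x + y) = ((s\<^sup>2 + s * g) * a1 + (1 + s * h) * b1, (s\<^sup>2 + s * g) * a2 + (1 + s * h) * b2)"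
      unfolding qz by (simp add: c algebra_simps)
    also have "\<dots> = k *\<^sub>R (?q x + ?q y)"
      unfolding k1 by (simp add: k_def qx qy algebra_simps)
    finally have "?q x + ?q y = (1 / k) *\<^sub>R ?q (s *\<^sub>R x + y)"
      using s(2) by (simp add: k_def)
    then show ?thesis
      using s(2) T xy by (auto intro!: nonneg_scaleR_joint_range simp: k_def subspace_add subspace_scale)
  qed
qed

lemma joint_range_convex_cone:
  assumes "subspace T"
  shows "cone (joint_quadratic A B ` T)" "convex (joint_quadratic A B ` T)"
proof -
  show cone: "cone (joint_quadratic A B ` T)"
    using nonneg_scaleR_joint_range[OF assms] by (auto simp: cone_def)
  show "convex (joint_quadratic A B ` T)"
    unfolding convex_def
  proof (intro ballI allI impI)
    fix v w and a b :: real
    assume "v \<in> joint_quadratic A B ` T" "w \<in> joint_quadratic A B ` T" "0 \<le> a" "0 \<le> b"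
    then have "a *\<^sub>R v \<in> joint_quadratic A B ` T" "b *\<^sub>R w \<in> joint_quadratic A B ` T"
      using cone by (auto simp only: cone_def)
    then show "a *\<^sub>R v + b *\<^sub>R w \<in> joint_quadratic A B ` T"
      by (elim imageE) (simp only: joint_range_add[OF assms])
  qed
qed

section \<open>First-order cones\<close>

text \<open>\<open>T\<close> replaces the ray by the whole line through \<open>d\<close>. Negating a
  point whose coefficient of \<open>d\<close> is negative brings it into \<open>K\<close>, so an
  even function has the same values on \<open>K\<close> as on \<open>T\<close>.\<close>

lemma first_order_cone_subspace:
  assumes "first_order_cone K"
  obtains T where "subspace T" "K \<subseteq> T" "\<And>x. x \<in> T \<Longrightarrow> x \<in> K \<or> - x \<in> K"
proof -
  obtain S d where S: "subspace S" and K: "K = {s + t *\<^sub>R d | s t. s \<in> S \<and> t \<ge> 0}"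
    using assms unfolding first_order_cone_def by blast
  define T where "T = {s + t *\<^sub>R d | s t. s \<in> S}"
  have T_sums: "T = {x + y | x y. x \<in> S \<and> y \<in> span {d}}"
    by (auto simp: T_def span_singleton)
  show ?thesis
  proof
    show "subspace T" unfolding T_sums using S by (intro subspace_sums) auto
    show "K \<subseteq> T" by (auto simp: T_def K)
    fix x assume "x \<in> T"
    then obtain s t where x: "x = s + t *\<^sub>R d" "s \<in> S" by (auto simp: T_def)
    show "x \<in> K \<or> - x \<in> K"
    proof (cases "t \<ge> 0")
      case True
      with x show ?thesis by (auto simp: K)
    next
      case False
      have "- x = - s + (- t) *\<^sub>R d" by (simp add: x)
      moreover have "- s \<in> S" using S x by (simp add: subspace_neg)
      ultimately show ?thesis using False by (auto simp: K intro!: exI[of _ "- s"] exI[of _ "- t"])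
    qed
  qed
qed

lemma quadratic_form_sum:
  fixes A :: "'i \<Rightarrow> real^'n^'n"
  shows "x \<bullet> ((\<Sum>i\<in>I. t i *\<^sub>R A i) *v x) = (\<Sum>i\<in>I. t i * (x \<bullet> (A i *v x)))"
  by (induction I rule: infinite_finite_induct)
    (simp_all add: matrix_vector_mult_add_rdistrib inner_add_right scaleR_matrix_vector_assoc[symmetric])

theorem lemma2:
  fixes A :: "nat \<Rightarrow> real^'n^'n" and m :: nat and K :: "(real^'n) set"
  assumes "m \<ge> 2"
    and "\<forall>i\<in>{3..m}. \<exists>\<alpha> \<beta> :: real. A i = \<alpha> *\<^sub>R A 1 + \<beta> *\<^sub>R A 2"
    and "first_order_cone K"
  shows "(\<forall>x\<in>K. Max ((\<lambda>i. x \<bullet> (A i *v x)) ` {1..m}) \<ge> 0) \<longleftrightarrow>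
         (\<exists>t\<in>unit_simplex m. psd_on (\<Sum>i=1..m. t i *\<^sub>R A i) K)"
proof -
  have Max_iff: "Max ((\<lambda>i. x \<bullet> (A i *v x)) ` {1..m}) \<ge> 0 \<longleftrightarrow> (\<exists>i\<in>{1..m}. x \<bullet> (A i *v x) \<ge> 0)" for x
    using assms(1) by (subst Max_ge_iff) auto
  show ?thesis
    unfolding Max_iff
  proof
    assume max: "\<forall>x\<in>K. \<exists>i\<in>{1..m}. x \<bullet> (A i *v x) \<ge> 0"
    obtain T where T: "subspace T" "K \<subseteq> T" and neg: "\<And>x. x \<in> T \<Longrightarrow> x \<in> K \<or> - x \<in> K"
      by (rule first_order_cone_subspace[OF assms(3)]) blast
    let ?q = "joint_quadratic (A 1) (A 2)"
    \<comment> \<open>The coefficients of \<open>A i\<close> in terms of \<open>A 1\<close> and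
      \<open>A 2\<close> serve as the functional; the indices 1 and 2 get the unit vectors.\<close>
    have "\<exists>l. \<forall>x. x \<bullet> (A i *v x) = l \<bullet> ?q x" if i: "i \<in> {1..m}" for i
    proof -
      have "\<exists>\<alpha> \<beta> :: real. A i = \<alpha> *\<^sub>R A 1 + \<beta> *\<^sub>R A 2"
      proof -
        consider "i = 1" | "i = 2" | "i \<in> {3..m}" using i by force
        then show ?thesis
        proof cases
          case 1
          then show ?thesis by (intro exI[of _ 1] exI[of _ 0]) simp
        next
          case 2
          then show ?thesis by (intro exI[of _ 0] exI[of _ 1]) simp
        qed (use assms(2) in blast)
      qed
      then obtain \<alpha> \<beta> where "A i = \<alpha> *\<^sub>R A 1 + \<beta> *\<^sub>R A 2" by blast
      then have "x \<bullet> (A i *v x) = (\<alpha>, \<beta>) \<bullet> ?q x" for x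
        by (simp add: joint_quadratic_def matrix_vector_mult_add_rdistrib inner_add_right
            scaleR_matrix_vector_assoc[symmetric])
      then show ?thesis by blast
    qed
    then obtain l where l: "\<And>i x. i \<in> {1..m} \<Longrightarrow> x \<bullet> (A i *v x) = l i \<bullet> ?q x"
      by metis
    have even: "?q (- x) = ?q x" for x
      using joint_quadratic_scaleR[of "A 1" "A 2" "-1" x] by simp
    \<comment> \<open>Condition (1) is assumed only on \<open>K\<close>, but by evenness every point
      of the joint range over \<open>T\<close> is attained on \<open>K\<close>.\<close>
    have "\<exists>i\<in>{1..m}. l i \<bullet> w \<ge> 0" if "w \<in> ?q ` T" for w
    proof -
      from that obtain x where "x \<in> T" "w = ?q x" by blast
      with neg[of x] even[of x] obtain z where "z \<in> K" "w = ?q z" by metis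
      moreover from max \<open>z \<in> K\<close> obtain i where "i \<in> {1..m}" "z \<bullet> (A i *v z) \<ge> 0" by blast
      ultimately show ?thesis using l[of i z] by auto
    qed
    moreover have "?q ` T \<noteq> {}" using T(1) subspace_0 by blast
    moreover have "{1..m} \<noteq> {}" using assms(1) by simp
    ultimately obtain t where t: "\<forall>i\<in>{1..m}. t i \<ge> 0" "sum t {1..m} = 1"
      and tT: "\<forall>w\<in>?q ` T. (\<Sum>i\<in>{1..m}. t i * (l i \<bullet> w)) \<ge> 0"
      using convex_cone_alternative[OF joint_range_convex_cone[OF T(1)] _ finite_atLeastAtMost]
      by blast
    have "psd_on (\<Sum>i=1..m. t i *\<^sub>R A i) K"
      unfolding psd_on_def quadratic_form_sum using tT T(2) by (auto simp: l)
    with t show "\<exists>t\<in>unit_simplex m. psd_on (\<Sum>i=1..m. t i *\<^sub>R A i) K"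
      unfolding unit_simplex_def by blast
  next
    assume "\<exists>t\<in>unit_simplex m. psd_on (\<Sum>i=1..m. t i *\<^sub>R A i) K"
    then obtain t where t: "\<forall>i\<in>{1..m}. t i \<ge> 0" "sum t {1..m} = 1"
      and psd: "\<And>x. x \<in> K \<Longrightarrow> (\<Sum>i=1..m. t i * (x \<bullet> (A i *v x))) \<ge> 0"
      unfolding unit_simplex_def psd_on_def quadratic_form_sum by blast
    show "\<forall>x\<in>K. \<exists>i\<in>{1..m}. x \<bullet> (A i *v x) \<ge> 0"
    proof (intro ballI, rule ccontr)
      fix x assume "x \<in> K" and "\<not> (\<exists>i\<in>{1..m}. x \<bullet> (A i *v x) \<ge> 0)"
      then have neg: "x \<bullet> (A i *v x) < 0" if "i \<in> {1..m}" for i using that by (meson not_le)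
      \<comment> \<open>Weights summing to 1 cannot all vanish; a positive one makes the weighted
        sum strictly negative.\<close>
      obtain j where j: "j \<in> {1..m}" "t j > 0"
        using t by (metis less_eq_real_def sum.neutral zero_neq_one)
      have "(\<Sum>i=1..m. t i * (x \<bullet> (A i *v x))) < (\<Sum>i=1..m. 0)"
      proof (rule sum_strict_mono_ex1)
        show "\<forall>i\<in>{1..m}. t i * (x \<bullet> (A i *v x)) \<le> 0"
          using neg t(1) by (meson less_imp_le mult_nonneg_nonpos)
        show "\<exists>i\<in>{1..m}. t i * (x \<bullet> (A i *v x)) < 0"
          using neg j by (meson mult_pos_neg)
      qed simp
      with psd[OF \<open>x \<in> K\<close>] show False by simp
    qed
  qed
qed

end
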